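(* Let $Y$ be a smooth Calabi-Yau threefold and $C\simeq\mathbb P^1\subset Y$ a smoothly embedded contractible rational curve, with local genus zero Gopakumar-Vafa (GV) spectrum $(n_d)_{d\ge1}$, support $S=\{d\ge1:n_d\ne0\}$ and lattice normalization $g=\gcd S$. Let $\mathcal R_g(\lambda,q)=\Delta_g\mathcal F_C^{\mathrm{loc}}$ be the full quantum forcing and $R_g(q)=\mathcal R_g(0,q)$ the classical forcing. Fix the exceptional ray and its lattice normalization $g$. Then $R_g(q)$ uniquely determines the local genus zero GV spectrum; more precisely, for every $N\ge1$, $$n_{gN}=-\frac1{N^2}\sum_{r\mid N}\frac{\mu(r)}r\,[q^{gN/r}]R_g(q),$$ where $\mu$ is the Möbius function and $[q^M]$ denotes the coefficient of $q^M$. Consequently, the three data $$\mathcal R_g(\lambda,q),\qquad R_g(q),\qquad \{n_{gN}\}_{N\ge1}$$ mutually determine one another.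
   Context: The local genus zero GV spectrum of $C$ is the finite sequence of integers $n_1,\dots,n_\ell$ given by the Bryan-Katz-Leung Hilbert scheme multiplicities of $C$ in degrees $1\le d\le \ell$, where $1\le\ell\le 6$ is Kollár's length; set $n_d=0$ for $d>\ell$. The support $S=\{d\ge 1: n_d\neq 0\}$ is finite and nonempty. The nonconstant local Gromov-Witten contribution of $C$ is $\mathcal F_C^{\mathrm{loc}}(\lambda,t)=\sum_{d\in S}n_d\Phi_d$, where $$\Phi_d(\lambda,t)=\sum_{k\ge1}\frac{q^{dk}}{k(2\sin(k\lambda/2))^2}\in\mathbb C((\lambda))[[q]],\qquad q=e^{2\pi i t}.$$ Put $h=\lambda/(2\pi)$ and $T_af(t)=f(t+a)$, so that $T_a q^N=e^{2\pi i N a}q^N$ (in particular $T_{h/g}q^N=e^{iN\lambda/g}q^N$). Define $\Delta_g=T_{h/g}-2+T_{-h/g}$. The coefficients of $\mathcal R_g=\Delta_g\mathcal F_C^{\mathrm{loc}}$ as a series in $q$ are regular at $\lambda=0$ (i.e. $\mathcal R_g\in\mathbb C[[\lambda]][[q]]$), so the specialization $R_g(q)=\mathcal R_g(0,q)$ is defined. "Mutually determine one another" means: for two such local geometries whose exceptional rays are identified with the same lattice normalization $g$, equality of any one of the three data implies equality of the other two. The normalization $g$ is regarded as part of the given data. *)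

theory Defs
  imports "HOL-Analysis.Analysis" "HOL-Computational_Algebra.Computational_Algebra"
begin

section \<open>Local genus zero spectra\<close>

text \<open>
  A spectrum is a function \<open>n :: nat \<Rightarrow> int\<close>; degrees are the \<open>d \<ge> 1\<close>, and the value
  \<open>n 0\<close> never plays a role. A contractible smooth rational curve in a Calabi-Yau threefold is
  represented only by its numerical output: the Hilbert scheme multiplicities
  \<open>n\<^sub>1, \<dots>, n\<^sub>l\<close>, extended by zero, where \<open>l\<close> is the length in the sense of Kollar.
  Any integers, not all zero, are admitted.
\<close>

definition gv_support :: "(nat \<Rightarrow> int) \<Rightarrow> nat set" where
  "gv_support n = {d. d \<ge> 1 \<and> n d \<noteq> 0}"

definition local_gv_spectrum :: "nat \<Rightarrow> (nat \<Rightarrow> int) \<Rightarrow> bool" where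
  "local_gv_spectrum l n \<longleftrightarrow>
     1 \<le> l \<and> l \<le> 6 \<and> (\<forall>d>l. n d = 0) \<and> gv_support n \<noteq> {}"

definition lattice_normalization :: "(nat \<Rightarrow> int) \<Rightarrow> nat" where
  "lattice_normalization n = Gcd (gv_support n)"

section \<open>The local contribution\<close>

text \<open>
  \<open>complex fls fps\<close> is the ring of power series in \<open>q\<close> over the field of Laurent series in
  \<open>\<lambda>\<close>. Since \<open>fps_sin c\<close> is the series of \<open>sin (c \<lambda>)\<close>, the following is
  \<open>(2 sin (k \<lambda> / 2))\<^sup>2\<close>.
\<close>

definition sine_factor :: "nat \<Rightarrow> complex fls" where
  "sine_factor k = (2 * fps_to_fls (fps_sin (of_nat k / 2)))\<^sup>2"

text \<open>The sum over \<open>k \<ge> 1\<close> is taken in the \<open>q\<close>-adic topology; the index is shifted by one.\<close>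

definition Phi_term :: "nat \<Rightarrow> nat \<Rightarrow> complex fls fps" where
  "Phi_term d k = fps_const (1 / (of_nat k * sine_factor k)) * fps_X ^ (d * k)"

definition Phi :: "nat \<Rightarrow> complex fls fps" where
  "Phi d = (\<Sum>k. Phi_term d (Suc k))"

definition F_loc :: "(nat \<Rightarrow> int) \<Rightarrow> complex fls fps" where
  "F_loc n = (\<Sum>d\<in>gv_support n. of_int (n d) * Phi d)"

section \<open>Translations and the forcings\<close>

text \<open>
  The translation \<open>t \<mapsto> t + a\<close> multiplies \<open>q\<^sup>N\<close> by \<open>exp (2 \<pi> \<i> N a)\<close>. Here \<open>a\<close> is a
  power series in \<open>\<lambda>\<close>; the composition with the exponential series is meaningful when its
  constant term vanishes, as it does for multiples of \<open>h_par = \<lambda> / (2 \<pi>)\<close>.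
\<close>

definition translate :: "complex fps \<Rightarrow> complex fls fps \<Rightarrow> complex fls fps" where
  "translate a F = Abs_fps (\<lambda>N.
     fps_to_fls (fps_exp 1 oo (fps_const (2 * of_real pi * \<i> * of_nat N) * a)) * fps_nth F N)"

definition h_par :: "complex fps" where
  "h_par = fps_const (1 / (2 * of_real pi)) * fps_X"

definition Delta :: "nat \<Rightarrow> complex fls fps \<Rightarrow> complex fls fps" where
  "Delta g F = translate (fps_const (1 / of_nat g) * h_par) F - 2 * F
               + translate (- (fps_const (1 / of_nat g) * h_par)) F"

definition quantum_forcing :: "nat \<Rightarrow> (nat \<Rightarrow> int) \<Rightarrow> complex fls fps" where
  "quantum_forcing g n = Delta g (F_loc n)"

text \<open>
  The value at \<open>\<lambda> = 0\<close> of a series whose coefficients are regular there; that the quantum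
  forcing is of this kind is \<open>quantum_forcing_regular\<close> below.
\<close>

definition at_lambda_0 :: "complex fls fps \<Rightarrow> complex fps" where
  "at_lambda_0 F = Abs_fps (\<lambda>N. fls_nth (fps_nth F N) 0)"

definition classical_forcing :: "nat \<Rightarrow> (nat \<Rightarrow> int) \<Rightarrow> complex fps" where
  "classical_forcing g n = at_lambda_0 (quantum_forcing g n)"

section \<open>The Moebius function\<close>

definition moebius_mu :: "nat \<Rightarrow> int" where
  "moebius_mu r = (if squarefree r then (- 1) ^ card (prime_factors r) else 0)"

section \<open>Well-definedness\<close>

lemma fps_sums_coeffwise:
  fixes f :: "nat \<Rightarrow> 'a :: comm_ring_1 fps"
  assumes "\<And>k N. N < k \<Longrightarrow> fps_nth (f k) N = 0"
  shows "f sums Abs_fps (\<lambda>N. \<Sum>k\<le>N. fps_nth (f k) N)"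
  unfolding sums_def
proof (rule metric_LIMSEQ_I)
  fix e :: real assume "e > 0"
  obtain M where M: "inverse (2 ^ M) < e"
    using real_arch_pow_inv[of e "1/2"] \<open>e > 0\<close> by (auto simp: power_one_over inverse_eq_divide)
  define s where "s = Abs_fps (\<lambda>N. \<Sum>k\<le>N. fps_nth (f k) N)"
  show "\<exists>m0. \<forall>m\<ge>m0. dist (\<Sum>k<m. f k) (Abs_fps (\<lambda>N. \<Sum>k\<le>N. fps_nth (f k) N)) < e"
  proof (intro exI allI impI)
    fix m assume m: "m \<ge> Suc M"
    have nth: "fps_nth (sum f {..<m} - s) N = 0" if "N < m" for N
    proof -
      have "(\<Sum>k<m. fps_nth (f k) N) = (\<Sum>k\<le>N. fps_nth (f k) N)"
        using that assms by (intro sum.mono_neutral_right) auto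
      thus ?thesis by (simp add: s_def fps_sum_nth)
    qed
    have "dist (sum f {..<m}) s < e"
    proof (cases "sum f {..<m} = s")
      case False
      hence "M \<le> subdegree (sum f {..<m} - s)"
        using m nth by (intro subdegree_geI) auto
      hence "inverse (2 ^ subdegree (sum f {..<m} - s)) \<le> inverse ((2::real) ^ M)"
        by (intro le_imp_inverse_le power_increasing) auto
      hence "inverse (2 ^ subdegree (sum f {..<m} - s)) < e"
        using M by linarith
      thus ?thesis using False unfolding dist_fps_def by simp
    qed (use \<open>e > 0\<close> in simp)
    thus "dist (sum f {..<m}) (Abs_fps (\<lambda>N. \<Sum>k\<le>N. fps_nth (f k) N)) < e"
      by (simp add: s_def)
  qed
qed

lemma Phi_term_nth:
  "fps_nth (Phi_term d k) N = (if N = d * k then 1 / (of_nat k * sine_factor k) else 0)"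
  by (simp add: Phi_term_def)

lemma Phi_sums:
  assumes "d \<ge> 1"
  shows "(\<lambda>k. Phi_term d (Suc k)) sums Phi d"
proof -
  have "N < d * Suc k" if "N < k" for N k :: nat
    using that assms by (metis Suc_lessD less_Suc_eq_le less_le_trans mult_le_mono1 nat_mult_1)
  hence "fps_nth (Phi_term d (Suc k)) N = 0" if "N < k" for N k
    using that by (metis Phi_term_nth less_irrefl)
  from fps_sums_coeffwise[OF this] show ?thesis
    unfolding Phi_def by (meson sums_summable summable_sums)
qed

lemma Phi_nth:
  assumes "d \<ge> 1"
  shows "fps_nth (Phi d) N =
    (if d dvd N \<and> N > 0 then 1 / (of_nat (N div d) * sine_factor (N div d)) else 0)"
proof -
  have *: "N < d * Suc k" if "N < k" for N k :: nat
    using that assms by (metis Suc_lessD less_Suc_eq_le less_le_trans mult_le_mono1 nat_mult_1)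
  hence "fps_nth (Phi_term d (Suc k)) N = 0" if "N < k" for N k
    using that by (metis Phi_term_nth less_irrefl)
  from sums_unique2[OF fps_sums_coeffwise[OF this] Phi_sums[OF assms]]
  have "fps_nth (Phi d) N = (\<Sum>k\<le>N. fps_nth (Phi_term d (Suc k)) N)"
    by (metis fps_nth_Abs_fps)
  also have "\<dots> = (\<Sum>k\<in>{k. k \<le> N \<and> N = d * Suc k}. 1 / (of_nat (Suc k) * sine_factor (Suc k)))"
    by (rule sum.mono_neutral_cong_right) (auto simp: Phi_term_nth simp del: of_nat_Suc)
  also have "\<dots> = (if d dvd N \<and> N > 0 then 1 / (of_nat (N div d) * sine_factor (N div d)) else 0)"
  proof (cases "d dvd N \<and> N > 0")
    case True
    then obtain j where j: "N = d * j" by auto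
    with True obtain i where i: "j = Suc i" by (cases j) auto
    have "{k. k \<le> N \<and> N = d * Suc k} = {i}"
      using assms *[of N] unfolding j i by (auto intro!: leI simp del: mult_Suc_right)
    moreover have "N div d = Suc i" using j i assms by simp
    ultimately show ?thesis using True by simp
  next
    case False
    hence "{k. k \<le> N \<and> N = d * Suc k} = {}" using assms by auto
    thus ?thesis using False by (simp only: if_False sum.empty)
  qed
  finally show ?thesis .
qed

lemma Delta_nth:
  "fps_nth (Delta g F) N =
     fps_to_fls (fps_exp (\<i> * of_nat N / of_nat g) - 2 + fps_exp (- \<i> * of_nat N / of_nat g))
     * fps_nth F N"
proof -
  have 1: "fps_const (2 * of_real pi * \<i> * of_nat N) * (fps_const (1 / of_nat g) * h_par)
        = fps_const (\<i> * of_nat N / of_nat g) * fps_X"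
    by (simp add: h_par_def flip: mult.assoc)
  have 2: "fps_const (2 * of_real pi * \<i> * of_nat N) * - (fps_const (1 / of_nat g) * h_par)
        = fps_const (- \<i> * of_nat N / of_nat g) * fps_X"
    using arg_cong[OF 1, of uminus] by (simp flip: fps_const_neg)
  have 3: "fps_nth (2 * F) N = 2 * fps_nth F N"
    by (simp add: numeral_fps_const)
  show ?thesis
    unfolding Delta_def translate_def fps_add_nth fps_sub_nth fps_nth_Abs_fps 1 2 3
      fps_exp_compose_linear
    by (simp add: algebra_simps)
qed

lemma exp_quotient_regular:
  assumes "k \<ge> 1"
  shows "\<exists>r. fps_to_fls (fps_exp c - 2 + fps_exp (- c)) / (of_nat k * sine_factor k) = fps_to_fls r
             \<and> fps_nth r 0 = c\<^sup>2 / of_nat k ^ 3"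
proof -
  define w :: "complex fps" where "w = fps_exp c - 2 + fps_exp (- c)"
  define v where "v = fps_shift 2 w"
  define u :: "complex fps" where "u = fps_shift 1 (fps_sin (of_nat k / 2))"
  define p where "p = of_nat k * (2 * u)\<^sup>2"
  have w: "w = v * fps_X ^ 2"
  proof -
    have "fps_nth w i = 0" if "i < 2" for i
      using that by (cases i) (auto simp: w_def numeral_fps_const)
    hence "w = 0 \<or> 2 \<le> subdegree w" using subdegree_geI by blast
    thus ?thesis unfolding v_def by (auto simp: fps_shift_times_fps_X_power)
  qed
  have s: "fps_sin (of_nat k / 2) = u * fps_X"
    unfolding u_def by (intro fps_ext) (simp add: fps_sin_def)
  have p0: "fps_nth p 0 = of_nat k ^ 3"
    by (simp add: p_def u_def fps_nth_power_0 fps_sin_def power2_eq_square power3_eq_cube)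
  have sf: "of_nat k * sine_factor k = fps_to_fls (p * fps_X ^ 2)"
    unfolding sine_factor_def s p_def
    by (simp add: fls_times_fps_to_fls fps_to_fls_power power_mult_distrib mult_ac)
  have "fps_nth p 0 \<noteq> 0" using assms p0 by simp
  hence p_inv: "p * inverse p = 1" and pnz: "p \<noteq> 0"
    by (auto simp: mult.commute[of p] inverse_mult_eq_1)
  have "fps_to_fls w / (of_nat k * sine_factor k) = fps_to_fls (v * inverse p)"
  proof -
    have "fps_to_fls (v * inverse p) * (of_nat k * sine_factor k)
        = fps_to_fls (v * fps_X ^ 2 * (p * inverse p))"
      unfolding sf by (simp only: fls_times_fps_to_fls mult_ac)
    moreover have "of_nat k * sine_factor k \<noteq> 0"
      unfolding sf using pnz by simp
    ultimately show ?thesis by (simp add: p_inv w field_simps)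
  qed
  moreover have "fps_nth (v * inverse p) 0 = c\<^sup>2 / of_nat k ^ 3"
    by (simp add: p0 v_def w_def numeral_fps_const numeral_2_eq_2 field_simps)
  ultimately show ?thesis unfolding w_def by blast
qed

lemma quantum_forcing_regular:
  "0 \<le> fls_subdegree (fps_nth (quantum_forcing g n) N)"
proof -
  define c where "c = \<i> * of_nat N / of_nat g"
  define W where "W = fps_to_fls (fps_exp c - 2 + fps_exp (- c))"
  have "\<exists>r. W * fps_nth (of_int (n d) * Phi d) N = fps_to_fls r" if "d \<in> gv_support n" for d
  proof (cases "d dvd N \<and> N > 0")
    case True
    have d: "d \<ge> 1" using that by (simp add: gv_support_def)
    with True have "N div d \<ge> 1" by (auto elim!: dvdE)
    from exp_quotient_regular[OF this, of c] obtain r where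
      "W / (of_nat (N div d) * sine_factor (N div d)) = fps_to_fls r"
      unfolding W_def by blast
    moreover have "W * fps_nth (of_int (n d) * Phi d) N
        = of_int (n d) * (W / (of_nat (N div d) * sine_factor (N div d)))"
      using True d by (simp add: Phi_nth fps_of_int[symmetric])
    ultimately have "W * fps_nth (of_int (n d) * Phi d) N = fps_to_fls (of_int (n d) * r)"
      by (simp only: fls_times_fps_to_fls fps_to_fls_of_int)
    thus ?thesis by blast
  next
    case False
    hence "W * fps_nth (of_int (n d) * Phi d) N = fps_to_fls 0"
      using that by (auto simp: Phi_nth fps_of_int[symmetric] gv_support_def)
    thus ?thesis by blast
  qed
  then obtain r where r:
    "\<And>d. d \<in> gv_support n \<Longrightarrow> W * fps_nth (of_int (n d) * Phi d) N = fps_to_fls (r d)"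
    by metis
  have "fps_nth (quantum_forcing g n) N = (\<Sum>d\<in>gv_support n. W * fps_nth (of_int (n d) * Phi d) N)"
    unfolding quantum_forcing_def Delta_nth F_loc_def W_def c_def
    by (simp add: fps_sum_nth sum_distrib_left)
  also have "\<dots> = fps_to_fls (\<Sum>d\<in>gv_support n. r d)"
  proof -
    have "(\<Sum>d\<in>D. fps_to_fls (r d)) = fps_to_fls (\<Sum>d\<in>D. r d)" for D
      by (induction D rule: infinite_finite_induct) auto
    thus ?thesis using r by simp
  qed
  finally show ?thesis by (simp add: fls_subdegree_fls_to_fps_gt0)
qed

end

theory Submission
  imports Defs
begin

text \<open>
  The second difference multiplies \<open>q\<^sup>N\<close> by \<open>2 cos (N \<lambda> / g) - 2 = - (N \<lambda> / g)\<^sup>2 + \<dots>\<close>, which cancels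
  the double pole of the sine factor. Writing \<open>N = g M\<close>, the value at \<open>\<lambda> = 0\<close> of the coefficient of
  \<open>q\<^sup>N\<close> is therefore \<open>- 1 / M\<close> times the divisor sum of \<open>e\<^sup>3 n (g e)\<close> over \<open>e dvd M\<close>, and Moebius
  inversion recovers the spectrum on multiples of \<open>g\<close>. Off these multiples it vanishes, and both
  forcings are functions of the spectrum.
\<close>

text \<open>Only squarefree divisors contribute, and they correspond to subsets of the prime factors
  of \<open>N\<close>. The signed count of these subsets is the expanded product of
  \<open>1 - 1\<close> over the primes, which is nonzero only when empty.\<close>

lemma sum_moebius_mu_divisors:
  assumes "N > 0"
  shows "(\<Sum>r | r dvd N. moebius_mu r) = (if N = 1 then 1 else 0)"
proof -
  \<comment> \<open>A set of primes is recovered from its product; this makes \<open>Prod\<close>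
    inverse to \<open>prime_factors\<close> and also yields the divisibility by comparing
    factorizations.\<close>
  have prod_inv: "prime_factorization (\<Prod>A) = mset_set A" if "A \<subseteq> prime_factors N" for A
  proof -
    have "finite A" using that finite_subset by blast
    hence "\<Prod>A = prod_mset (mset_set A)" by (simp add: prod_unfold_prod_mset)
    thus ?thesis using that \<open>finite A\<close>
      by (auto intro!: prime_factorization_prod_mset_primes)
  qed
  have "bij_betw prime_factors {r. r dvd N \<and> squarefree r} (Pow (prime_factors N))"
  proof (rule bij_betw_byWitness[where f' = Prod])
    show "\<forall>r\<in>{r. r dvd N \<and> squarefree r}. \<Prod>(prime_factors r) = r"
    proof clarify
      fix r assume r: "r dvd N" "squarefree r"
      with assms have "r \<noteq> 0" by auto
      hence "(\<Prod>p\<in>prime_factors r. p ^ multiplicity p r) = r"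
        by (simp add: prod_prime_factors)
      moreover have "(\<Prod>p\<in>prime_factors r. p ^ multiplicity p r) = \<Prod>(prime_factors r)"
        using r(2) \<open>r \<noteq> 0\<close> by (intro prod.cong) (auto simp: squarefree_factorial_semiring')
      ultimately show "\<Prod>(prime_factors r) = r" by simp
    qed
    show "\<forall>A\<in>Pow (prime_factors N). prime_factors (\<Prod>A) = A"
      using prod_inv finite_subset[OF _ finite_set_mset] by (metis PowD finite_set_mset_mset_set)
    show "prime_factors ` {r. r dvd N \<and> squarefree r} \<subseteq> Pow (prime_factors N)"
      using assms dvd_prime_factors[of N] by blast
    show "Prod ` Pow (prime_factors N) \<subseteq> {r. r dvd N \<and> squarefree r}"
    proof safe
      fix A assume A: "A \<subseteq> prime_factors N"
      hence "finite A" using finite_subset by blast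
      have nz: "\<Prod>A \<noteq> 0" using A \<open>finite A\<close> by (auto simp: prime_factors_dvd)
      have "mset_set A \<subseteq># prime_factorization N"
        using A \<open>finite A\<close> by (auto simp: subseteq_mset_def count_mset_set' Suc_le_eq)
      thus "\<Prod>A dvd N"
        using nz assms prod_inv[OF A] by (simp flip: prime_factorization_subset_iff_dvd)
      show "squarefree (\<Prod>A)"
        using A by (intro squarefree_prod_coprime squarefree_prime) (auto intro: primes_coprime)
    qed
  qed
  hence "(\<Sum>A\<in>Pow (prime_factors N). (- 1) ^ card A)
       = (\<Sum>r | r dvd N \<and> squarefree r. (- 1 :: int) ^ card (prime_factors r))"
    by (rule sum.reindex_bij_betw[symmetric])
  also have "\<dots> = (\<Sum>r | r dvd N. moebius_mu r)"
    using assms by (intro sum.mono_neutral_cong_left) (auto simp: moebius_mu_def)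
  finally have "(\<Sum>r | r dvd N. moebius_mu r) = (\<Prod>p\<in>prime_factors N. 1 - 1)"
    using prod_diff_conv_sum[of "prime_factors N" "\<lambda>_. 1 :: int" "\<lambda>_. 1"] by simp
  moreover have "prime_factors N = {} \<longleftrightarrow> N = 1"
    using assms by (simp add: prime_factorization_empty_iff)
  ultimately show ?thesis by (simp add: power_0_left)
qed

text \<open>Expanding \<open>F\<close> gives a sum over pairs with \<open>r * e\<close> dividing
  \<open>N\<close>. Summing over \<open>r\<close> first leaves, for each \<open>e\<close>, the
  Moebius sum of \<open>N div e\<close>, which vanishes unless \<open>e = N\<close>.\<close>

lemma moebius_inversion:
  fixes f F :: "nat \<Rightarrow> 'a :: comm_ring_1"
  assumes "N > 0" and F: "\<And>M. M > 0 \<Longrightarrow> F M = (\<Sum>e | e dvd M. f e)"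
  shows "(\<Sum>r | r dvd N. of_int (moebius_mu r) * F (N div r)) = f N"
proof -
  \<comment> \<open>The condition becomes symmetric in \<open>r\<close> and \<open>e\<close>, so the
    same fact serves before and after the exchange of sums.\<close>
  have divisors_quotient: "{e. e dvd N div r} = {e \<in> {e. e dvd N}. r * e dvd N}" if "r dvd N" for r
  proof -
    obtain c where c: "N = r * c" using \<open>r dvd N\<close> ..
    with assms(1) have "r > 0" by (cases r) auto
    with c show ?thesis by (auto intro: dvd_mult)
  qed
  have "(\<Sum>r | r dvd N. of_int (moebius_mu r) * F (N div r))
      = (\<Sum>r | r dvd N. \<Sum>e | e dvd N div r. of_int (moebius_mu r) * f e)"
    using assms by (intro sum.cong) (auto simp: sum_distrib_left elim!: dvdE)
  also have "\<dots> = (\<Sum>e | e dvd N. \<Sum>r | r dvd N div e. of_int (moebius_mu r) * f e)"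
  proof -
    have "(\<Sum>r | r dvd N. \<Sum>e | e dvd N div r. of_int (moebius_mu r) * f e)
        = (\<Sum>r | r dvd N. \<Sum>e\<in>{e \<in> {e. e dvd N}. r * e dvd N}. of_int (moebius_mu r) * f e)"
      by (intro sum.cong) (auto simp only: divisors_quotient mem_Collect_eq)
    also have "\<dots> = (\<Sum>e | e dvd N. \<Sum>r\<in>{r \<in> {r. r dvd N}. r * e dvd N}. of_int (moebius_mu r) * f e)"
      using assms(1) by (intro sum.swap_restrict) simp_all
    also have "\<dots> = (\<Sum>e | e dvd N. \<Sum>r | r dvd N div e. of_int (moebius_mu r) * f e)"
      by (intro sum.cong) (auto simp only: divisors_quotient mem_Collect_eq mult.commute)
    finally show ?thesis .
  qed
  also have "\<dots> = (\<Sum>e | e dvd N. of_int (\<Sum>r | r dvd N div e. moebius_mu r) * f e)"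
    by (simp add: sum_distrib_right)
  also have "\<dots> = (\<Sum>e | e dvd N. if e = N then f e else 0)"
  proof (intro sum.cong refl)
    fix e assume "e \<in> {e. e dvd N}"
    then obtain m where m: "N = e * m" by auto
    with assms(1) show "of_int (\<Sum>r | r dvd N div e. moebius_mu r) * f e = (if e = N then f e else 0)"
      by (simp add: sum_moebius_mu_divisors)
  qed
  finally show ?thesis using assms(1) by simp
qed

lemma gv_support_finite:
  assumes "local_gv_spectrum l n"
  shows "finite (gv_support n)"
proof (rule finite_subset)
  show "gv_support n \<subseteq> {..l}"
    using assms by (auto simp: gv_support_def local_gv_spectrum_def not_less[symmetric])
qed simp

lemma lattice_normalization_pos:
  assumes "local_gv_spectrum l n"
  shows "lattice_normalization n > 0"
  using assms by (auto simp: lattice_normalization_def local_gv_spectrum_def gv_support_def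
    intro!: Nat.gr0I)

lemma spectrum_zero_off_lattice:
  assumes "d \<ge> 1" "\<not> lattice_normalization n dvd d"
  shows "n d = 0"
  using assms Gcd_dvd[of d "gv_support n"] by (auto simp: lattice_normalization_def gv_support_def)

text \<open>Spectra may differ at \<open>0\<close>, so agreement in positive degrees is carried over
  through \<open>gv_support\<close>.\<close>

lemma quantum_forcing_cong:
  assumes "\<And>d. d \<ge> 1 \<Longrightarrow> n d = n' d"
  shows "quantum_forcing g n = quantum_forcing g n'"
proof -
  have "gv_support n = gv_support n'" using assms by (auto simp: gv_support_def)
  moreover have "n d = n' d" if "d \<in> gv_support n'" for d
    using assms that by (auto simp: gv_support_def)
  ultimately have "F_loc n = F_loc n'" by (simp add: F_loc_def)
  thus ?thesis by (simp add: quantum_forcing_def)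
qed

text \<open>For \<open>N = d * k\<close>, the quotient of the second difference by the sine factor
  has constant term \<open>c\<^sup>2 / k ^ 3\<close> with \<open>c = \<i> * N / g\<close>, and this
  equals \<open>- d ^ 3 / (g ^ 2 * N)\<close>.\<close>

lemma classical_forcing_nth:
  assumes "finite (gv_support n)" "N > 0"
  shows "fps_nth (classical_forcing g n) N
       = - (\<Sum>d | d dvd N. of_int (n d) * of_nat d ^ 3) / (of_nat g ^ 2 * of_nat N)"
proof -
  define c where "c = \<i> * of_nat N / of_nat g"
  define W where "W = fps_to_fls (fps_exp c - 2 + fps_exp (- c))"
  have nth_sum: "fls_nth (\<Sum>d\<in>D. f d) 0 = (\<Sum>d\<in>D. fls_nth (f d) 0)"
    for f :: "nat \<Rightarrow> complex fls" and D
    by (induction D rule: infinite_finite_induct) auto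
  have coeff: "fls_nth (W * fps_nth (of_int (n d) * Phi d) N) 0
      = (if d dvd N then - (of_int (n d) * of_nat d ^ 3) / (of_nat g ^ 2 * of_nat N) else 0)"
    if "d \<in> gv_support n" for d
  proof (cases "d dvd N")
    case True
    then obtain k where k: "N = d * k" by auto
    have d: "d \<ge> 1" using that by (simp add: gv_support_def)
    have k1: "k \<ge> 1" using k assms(2) by (cases k) auto
    from exp_quotient_regular[OF this, of c] obtain r where
      r: "W / (of_nat k * sine_factor k) = fps_to_fls r" "fps_nth r 0 = c\<^sup>2 / of_nat k ^ 3"
      unfolding W_def by blast
    have "W * fps_nth (of_int (n d) * Phi d) N = of_int (n d) * (W / (of_nat k * sine_factor k))"
      using k1 d by (simp add: k Phi_nth fps_of_int[symmetric])
    also have "\<dots> = fps_to_fls (of_int (n d) * r)"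
      by (simp only: r fls_times_fps_to_fls fps_to_fls_of_int)
    finally have "fls_nth (W * fps_nth (of_int (n d) * Phi d) N) 0 = of_int (n d) * (c\<^sup>2 / of_nat k ^ 3)"
      by (simp add: r fps_of_int[symmetric])
    \<comment> \<open>This includes \<open>g = 0\<close>, where both sides vanish because division
      by zero gives zero.\<close>
    also have "\<dots> = - (of_int (n d) * of_nat d ^ 3) / (of_nat g ^ 2 * of_nat N)"
      using d k1 by (simp add: c_def k power2_eq_square power3_eq_cube field_simps)
    finally show ?thesis using True by simp
  next
    case False
    thus ?thesis using that by (simp add: Phi_nth fps_of_int[symmetric] gv_support_def)
  qed
  have "fps_nth (quantum_forcing g n) N = (\<Sum>d\<in>gv_support n. W * fps_nth (of_int (n d) * Phi d) N)"
    unfolding quantum_forcing_def Delta_nth F_loc_def W_def c_def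
    by (simp add: fps_sum_nth sum_distrib_left)
  hence "fps_nth (classical_forcing g n) N
      = (\<Sum>d\<in>gv_support n. fls_nth (W * fps_nth (of_int (n d) * Phi d) N) 0)"
    by (simp only: classical_forcing_def at_lambda_0_def fps_nth_Abs_fps nth_sum)
  also have "\<dots> = (\<Sum>d\<in>gv_support n. if d dvd N
                     then - (of_int (n d) * of_nat d ^ 3) / (of_nat g ^ 2 * of_nat N) else 0)"
    using coeff by (rule sum.cong[OF refl])
  also have "\<dots> = (\<Sum>d\<in>gv_support n \<inter> {d. d dvd N}.
                     - (of_int (n d) * of_nat d ^ 3) / (of_nat g ^ 2 * of_nat N))"
    using assms(1) by (subst sum.inter_restrict) simp_all
  \<comment> \<open>Divisors of a positive \<open>N\<close> are positive, so those outside the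
    support have \<open>n d = 0\<close>.\<close>
  also have "\<dots> = (\<Sum>d | d dvd N. - (of_int (n d) * of_nat d ^ 3) / (of_nat g ^ 2 * of_nat N))"
    using assms(2) by (intro sum.mono_neutral_left) (auto simp: gv_support_def Suc_le_eq intro: Nat.gr0I)
  finally show ?thesis by (simp add: sum_divide_distrib sum_negf)
qed

text \<open>Only divisors \<open>g * e\<close> of \<open>g * M\<close> carry a nonzero value, and
  their factor \<open>g ^ 3\<close> cancels the denominator \<open>g ^ 2 * (g * M)\<close> up to
  \<open>M\<close>. Multiplying by \<open>M\<close> leaves a pure divisor sum, ready for
  inversion.\<close>

lemma classical_forcing_lattice_nth:
  assumes "local_gv_spectrum l n" "g = lattice_normalization n" "M > 0"
  shows "of_nat M * fps_nth (classical_forcing g n) (g * M)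
       = - (\<Sum>e | e dvd M. of_nat e ^ 3 * of_int (n (g * e)))"
proof -
  have g: "g > 0" using lattice_normalization_pos assms by simp
  have "(\<Sum>d | d dvd g * M. of_int (n d) * of_nat d ^ 3)
      = (\<Sum>d\<in>(*) g ` {e. e dvd M}. of_int (n d) * (of_nat d ^ 3 :: complex))"
  proof (intro sum.mono_neutral_right)
    show "\<forall>d\<in>{d. d dvd g * M} - (*) g ` {e. e dvd M}. of_int (n d) * (of_nat d ^ 3 :: complex) = 0"
    proof
      fix d assume d: "d \<in> {d. d dvd g * M} - (*) g ` {e. e dvd M}"
      have "\<not> g dvd d" using d g by (auto elim!: dvdE[of g])
      moreover have "d \<ge> 1" using d g assms(3) by (auto simp: Suc_le_eq intro: Nat.gr0I)
      ultimately show "of_int (n d) * (of_nat d ^ 3 :: complex) = 0"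
        using spectrum_zero_off_lattice assms(2) by simp
    qed
  qed (use g assms(3) in auto)
  also have "\<dots> = of_nat g ^ 3 * (\<Sum>e | e dvd M. of_nat e ^ 3 * of_int (n (g * e)))"
    using g by (subst sum.reindex)
      (auto simp: inj_on_def sum_distrib_left power_mult_distrib mult_ac)
  finally show ?thesis
    using g assms(3) classical_forcing_nth[OF gv_support_finite[OF assms(1)], of "g * M" g]
    by (simp add: power2_eq_square power3_eq_cube field_simps)
qed

text \<open>Inversion is applied to \<open>e ^ 3 * n (g * e)\<close>, whose divisor sums are
  \<open>- M\<close> times the coefficients at \<open>g * M\<close>. The factor \<open>N / r\<close>
  divided by \<open>N ^ 3\<close> becomes \<open>1 / (N\<^sup>2 * r)\<close>.\<close>

lemma gv_from_classical_forcing: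
  assumes "local_gv_spectrum l n" "g = lattice_normalization n" "N \<ge> 1"
  shows "of_int (n (g * N)) = - (1 / (of_nat N)\<^sup>2) *
            (\<Sum>r | r dvd N. of_int (moebius_mu r) / of_nat r *
                fps_nth (classical_forcing g n) (g * N div r))"
proof -
  define R where "R = fps_nth (classical_forcing g n)"
  define X where "X = (\<Sum>r | r dvd N. of_int (moebius_mu r) / of_nat r * R (g * N div r))"
  have "of_nat N ^ 3 * of_int (n (g * N))
      = (\<Sum>r | r dvd N. of_int (moebius_mu r) * - (of_nat (N div r) * R (g * (N div r))))"
    using assms classical_forcing_lattice_nth[OF assms(1,2)] unfolding R_def
    by (intro moebius_inversion[symmetric]) auto
  \<comment> \<open>As \<open>r\<close> divides \<open>N\<close>, truncated division is exact here,
    both in the index and in the factor \<open>N div r\<close>.\<close>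
  also have "\<dots> = (\<Sum>r | r dvd N. - of_nat N * (of_int (moebius_mu r) / of_nat r * R (g * N div r)))"
    using assms(3) by (intro sum.cong) (auto elim!: dvdE simp: field_simps)
  also have "\<dots> = - of_nat N * X"
    by (simp only: sum_distrib_left X_def)
  finally have cube: "of_nat N ^ 3 * of_int (n (g * N)) = - of_nat N * X" .
  have nz: "of_nat N \<noteq> (0 :: complex)" using assms(3) by simp
  hence "of_int (n (g * N)) = (of_nat N ^ 3 * of_int (n (g * N))) / (of_nat N ^ 3 :: complex)"
    by simp
  also have "\<dots> = - (1 / (of_nat N)\<^sup>2) * X"
    unfolding cube using nz by (simp add: power2_eq_square power3_eq_cube)
  finally show ?thesis unfolding X_def R_def .
qed

text \<open>Degrees off the common lattice carry the value zero in both spectra.\<close>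

lemma spectrum_eq_of_lattice_eq:
  assumes "lattice_normalization n = g" "lattice_normalization n' = g"
    and "\<forall>N\<ge>1. n (g * N) = n' (g * N)" "d \<ge> 1"
  shows "n d = n' d"
proof (cases "g dvd d")
  case True
  then obtain N where "d = g * N" by auto
  with assms show ?thesis by (cases N) auto
next
  case False
  with assms show ?thesis using spectrum_zero_off_lattice[of d] by metis
qed

theorem theorem1p1:
  fixes l g :: nat and n :: "nat \<Rightarrow> int"
  assumes "local_gv_spectrum l n" and "g = lattice_normalization n"
  shows
    "(\<forall>l' n'. local_gv_spectrum l' n' \<and> lattice_normalization n' = g \<and>
        classical_forcing g n = classical_forcing g n' \<longrightarrow> (\<forall>d\<ge>1. n d = n' d)) \<and>
     (\<forall>N\<ge>1.
        of_int (n (g * N)) =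
          - (1 / (of_nat N)\<^sup>2) *
            (\<Sum>r | r dvd N. of_int (moebius_mu r) / of_nat r *
                fps_nth (classical_forcing g n) (g * N div r))) \<and>
     (\<forall>l' n'. local_gv_spectrum l' n' \<and> lattice_normalization n' = g \<longrightarrow>
        (quantum_forcing g n = quantum_forcing g n' \<longrightarrow>
           classical_forcing g n = classical_forcing g n' \<and>
           (\<forall>N\<ge>1. n (g * N) = n' (g * N))) \<and>
        (classical_forcing g n = classical_forcing g n' \<longrightarrow>
           quantum_forcing g n = quantum_forcing g n' \<and>
           (\<forall>N\<ge>1. n (g * N) = n' (g * N))) \<and>
        ((\<forall>N\<ge>1. n (g * N) = n' (g * N)) \<longrightarrow>
           quantum_forcing g n = quantum_forcing g n' \<and>
           classical_forcing g n = classical_forcing g n'))"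
proof -
  \<comment> \<open>With \<open>g\<close> shared, the inversion formula has the same right-hand side
    for both spectra; integers embed injectively in the complex numbers.\<close>
  have lattice_eq: "\<forall>N\<ge>1. n (g * N) = n' (g * N)"
    if "local_gv_spectrum l' n'" "lattice_normalization n' = g"
      "classical_forcing g n = classical_forcing g n'" for l' n'
  proof (intro allI impI)
    fix N :: nat assume N: "N \<ge> 1"
    have "(of_int (n (g * N)) :: complex) = of_int (n' (g * N))"
      using gv_from_classical_forcing[OF assms N]
        gv_from_classical_forcing[OF that(1) that(2)[symmetric] N] that(3) by simp
    thus "n (g * N) = n' (g * N)" by simp
  qed
  have quantum_eq: "quantum_forcing g n = quantum_forcing g n'"
    if "lattice_normalization n' = g" "\<forall>N\<ge>1. n (g * N) = n' (g * N)" for n'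
    using spectrum_eq_of_lattice_eq[OF assms(2)[symmetric] that] by (rule quantum_forcing_cong)
  have classical_eq: "classical_forcing g n = classical_forcing g n'"
    if "quantum_forcing g n = quantum_forcing g n'" for n'
    using that by (simp add: classical_forcing_def)
  \<comment> \<open>The implications form a cycle: quantum forcing to classical forcing by
    specialization, then to lattice values by inversion, then back to quantum forcing.\<close>
  show ?thesis
    using lattice_eq quantum_eq classical_eq gv_from_classical_forcing[OF assms]
      spectrum_eq_of_lattice_eq[OF assms(2)[symmetric]]
    by (intro conjI allI impI) blast+
qed

end
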